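(* Let $q\ge1$ and let $A=(a_1,\ldots,a_q)$, $B=(b_1,\ldots,b_q)$ be real vectors with $B\prec^W A$, and let $0<\sigma\le\min(a_1,\ldots,a_q)$. Then $f(z):={}_{q+1}F_q(\sigma,A;B;-z)$ is a generalized Stieltjes function of the exact order $\sigma$. In particular, $f$ is completely monotonic (on $(0,\infty)$).
   Context: $B\prec^W A$ means: $0<a_1\le\cdots\le a_q$, $0<b_1\le\cdots\le b_q$, and $\sum_{i=1}^{k}a_i\le\sum_{i=1}^{k}b_i$ for $k=1,\ldots,q$. The generalized hypergeometric function is ${}_{q+1}F_q(\sigma,A;B;z)=\sum_{n=0}^{\infty}\frac{(\sigma)_n(a_1)_n\cdots(a_q)_n}{(b_1)_n\cdots(b_q)_n\,n!}z^n$ for $|z|<1$, extended by analytic continuation to $\mathbb{C}\setminus[1,\infty)$; $(a)_0=1$, $(a)_n=a(a+1)\cdots(a+n-1)$. For $\alpha>0$, the class $S_\alpha$ consists of functions $f$ on $\mathbb{C}\setminus(-\infty,0]$ representable in the form $$f(z)=C+\int_{[0,\infty)}\frac{\mu(du)}{(u+z)^{\alpha}},$$ where $C\ge0$ is a constant and $\mu$ is a non-negative measure supported on $[0,\infty)$ such that the integral converges for each $z\in\mathbb{C}\setminus(-\infty,0]$ (principal branch of the power). Functions in $\bigcup_{\alpha>0}S_\alpha$ are called generalized Stieltjes functions. One has $S_\alpha\subset S_\beta$ for $\alpha<\beta$. A function $f\in\bigcup_{\alpha>0}S_\alpha$ is of exact (Stieltjes) order $\alpha^*$ if $\alpha^*=\inf\{\alpha>0: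 f\in S_\alpha\}$. A function here defined on a larger domain is regarded as restricted to $\mathbb{C}\setminus(-\infty,0]$. *)

theory Defs
  imports "HOL-Complex_Analysis.Complex_Analysis"
begin

definition weak_supermaj :: "nat \<Rightarrow> (nat \<Rightarrow> real) \<Rightarrow> (nat \<Rightarrow> real) \<Rightarrow> bool" where
  (* the relation written B \<prec>^W A, with A = (a 1, ..., a q) and B = (b 1, ..., b q) *)
  "weak_supermaj q b a \<longleftrightarrow>
     (\<forall>i\<in>{1..q}. 0 < a i) \<and> mono_on {1..q} a \<and>
     (\<forall>i\<in>{1..q}. 0 < b i) \<and> mono_on {1..q} b \<and>
     (\<forall>k\<in>{1..q}. (\<Sum>i=1..k. a i) \<le> (\<Sum>i=1..k. b i))"

definition hypergeom_coeff :: "nat \<Rightarrow> real \<Rightarrow> (nat \<Rightarrow> real) \<Rightarrow> (nat \<Rightarrow> real) \<Rightarrow> nat \<Rightarrow> real" where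
  "hypergeom_coeff q \<sigma> a b n =
     pochhammer \<sigma> n * (\<Prod>i=1..q. pochhammer (a i) n) /
       ((\<Prod>i=1..q. pochhammer (b i) n) * fact n)"

lemma hypergeom_coeff_eq_fps_hypergeo:
  "hypergeom_coeff q \<sigma> a b n =
     fps_nth (fps_hypergeo (\<sigma> # map a [1..<Suc q]) (map b [1..<Suc q]) 1) n"
proof -
  have foldl: "foldl (\<lambda>r x. r * pochhammer x n) c (map g [1..<Suc q]) =
                 c * (\<Prod>i=1..q. pochhammer (g i) n)" for c :: real and g
    by (induction q) (simp_all add: mult.assoc)
  show ?thesis
    by (simp only: hypergeom_coeff_def fps_hypergeo_nth foldl.simps foldl) simp
qed

definition hypergeom_continuation ::
  "nat \<Rightarrow> real \<Rightarrow> (nat \<Rightarrow> real) \<Rightarrow> (nat \<Rightarrow> real) \<Rightarrow> (complex \<Rightarrow> complex) \<Rightarrow> bool" where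
  "hypergeom_continuation q \<sigma> a b F \<longleftrightarrow>
     F holomorphic_on - (of_real ` {1..}) \<and>
     (\<forall>z. norm z < 1 \<longrightarrow> (\<lambda>n. of_real (hypergeom_coeff q \<sigma> a b n) * z ^ n) sums F z)"

definition hypergeom :: "nat \<Rightarrow> real \<Rightarrow> (nat \<Rightarrow> real) \<Rightarrow> (nat \<Rightarrow> real) \<Rightarrow> complex \<Rightarrow> complex" where
  (* The choice is immaterial on the slit plane by the uniqueness lemma below; on the cut [1,oo)
     the value is unspecified.  That a continuation exists is not built into the definition. *)
  "hypergeom q \<sigma> a b = (SOME F. hypergeom_continuation q \<sigma> a b F)"

lemma hypergeom_continuation_unique:
  assumes F: "hypergeom_continuation q \<sigma> a b F" and z: "z \<notin> of_real ` {1..}"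
  shows "hypergeom q \<sigma> a b z = F z"
proof -
  let ?S = "- (of_real ` {1..}) :: complex set"
  let ?G = "hypergeom q \<sigma> a b"
  have G: "hypergeom_continuation q \<sigma> a b ?G"
    unfolding hypergeom_def using someI[of "hypergeom_continuation q \<sigma> a b", OF F] .
  have "closed (of_real ` {1..} :: complex set)"
    by (rule closed_injective_linear_image)
       (auto simp: linear_conv_bounded_linear bounded_linear_of_real intro: inj_of_real)
  then have op: "open ?S"
    by (rule open_Compl)
  have "starlike ?S"
    unfolding starlike_def
  proof (intro bexI[of _ 0] ballI subsetI)
    show "(0::complex) \<in> ?S"
      by auto
    fix x y assume x: "x \<in> ?S" and "y \<in> closed_segment 0 x"
    then obtain u where u: "0 \<le> u" "u \<le> 1" "y = u *\<^sub>R x"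
      by (auto simp: closed_segment_def)
    show "y \<in> ?S"
    proof
      assume "y \<in> of_real ` {1..}"
      then obtain t where t: "1 \<le> t" "u *\<^sub>R x = of_real t"
        using u by auto
      then have "u > 0"
        using u by (cases "u = 0") auto
      then have "x = of_real (t / u)"
        using t by (simp add: scaleR_conv_of_real field_simps)
      moreover have "1 \<le> t / u"
        using t u \<open>u > 0\<close> by simp
      ultimately show False
        using x by (metis ComplD atLeast_iff image_eqI)
    qed
  qed
  then have con: "connected ?S"
    by (rule starlike_imp_connected)
  have ball: "ball 0 1 \<subseteq> ?S"
    by auto
  show ?thesis
  proof (rule analytic_continuation_open[of "ball 0 1" ?S ?G F])
    fix w :: complex assume "w \<in> ball 0 1"
    then show "?G w = F w"
      using F G by (auto simp: hypergeom_continuation_def intro: sums_unique2)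
  qed (use F G z op con ball in \<open>auto simp: hypergeom_continuation_def\<close>)
qed

definition stieltjes_class :: "real \<Rightarrow> (complex \<Rightarrow> complex) set" where
  "stieltjes_class \<alpha> =
     {f. \<exists>C\<ge>0. \<exists>\<mu> :: real measure. sets \<mu> = sets borel \<and> emeasure \<mu> {..<0} = 0 \<and>
         (\<forall>z. z \<notin> \<real>\<^sub>\<le>\<^sub>0 \<longrightarrow>
            set_integrable \<mu> {0..} (\<lambda>u. 1 / (of_real u + z) powr of_real \<alpha>) \<and>
            f z = of_real C + (LINT u:{0..}|\<mu>. 1 / (of_real u + z) powr of_real \<alpha>))}"

definition generalized_stieltjes :: "(complex \<Rightarrow> complex) \<Rightarrow> bool" where
  "generalized_stieltjes f \<longleftrightarrow> (\<exists>\<alpha>>0. f \<in> stieltjes_class \<alpha>)"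

definition exact_stieltjes_order :: "(complex \<Rightarrow> complex) \<Rightarrow> real \<Rightarrow> bool" where
  "exact_stieltjes_order f \<alpha> \<longleftrightarrow>
     generalized_stieltjes f \<and> \<alpha> = Inf {\<beta>. 0 < \<beta> \<and> f \<in> stieltjes_class \<beta>}"

definition completely_monotonic :: "(real \<Rightarrow> real) \<Rightarrow> bool" where
  "completely_monotonic g \<longleftrightarrow>
     (\<forall>n. \<forall>x>0. (deriv ^^ n) g field_differentiable at x \<and> 0 \<le> (-1) ^ n * (deriv ^^ n) g x)"

end

theory Submission
  imports Defs "HOL-Probability.Probability"
begin

text \<open>
  The sequence $m_n = \prod_i (a_i)_n / (b_i)_n$ consists of the moments of a probability measure
  on $(0,1]$, and integrating the binomial series of $(1 + tz)^{-\sigma}$ against that measure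
  represents $f$ as a generalized Stieltjes function of order $\sigma$.

  Positivity comes from $B \prec^W A$: since $e^{-x}$ is convex and decreasing,
  $D(u) = \sum_i (e^{-a_i u} - e^{-b_i u}) \ge 0$, hence
  $\sum_i (1/(a_i+s) - 1/(b_i+s)) = \int_0^\infty D(u) e^{-su} du$ is completely monotonic in $s$, and so
  are its integral $\sum_i \ln ((b_i+s)/(a_i+s))$ over $[s,\infty)$, the exponential of the latter, and, by
  Euler's limit formula, $M(s) = \prod_i \Gamma(a_i+s)/\Gamma(b_i+s)$. Hausdorff's moment theorem then
  gives the measure.

  For the exact order, let $\gamma = p/N$ be rational with $\beta < \gamma < \sigma$. Applying Hausdorff's
  theorem to $M(n/N - \gamma)$, $n \ge 0$, yields a representing measure $\nu$ with
  $\int t^{-\gamma} d\nu < \infty$, so $f(x) = O(x^{-\gamma})$ as $x \to \infty$. A representation of $f$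
  of order $\beta$ would have $C \le f(x)$ and $\mu([0,T]) \le (T+x)^\beta f(x)$ for all $x > 0$,
  forcing $C = 0$ and $\mu = 0$.
\<close>

section \<open>Completely monotonic sequences\<close>

text \<open>The sign is opposite to that of the forward difference. The usual factors (-1)^k
  disappear, and complete monotonicity says that every iterate is nonnegative.\<close>

definition bdiff :: "(nat \<Rightarrow> real) \<Rightarrow> nat \<Rightarrow> real" where
  "bdiff m n = m n - m (Suc n)"

definition cm_seq :: "(nat \<Rightarrow> real) \<Rightarrow> bool" where
  "cm_seq m \<longleftrightarrow> (\<forall>k n. 0 \<le> (bdiff ^^ k) m n)"

lemma cm_seqD: "cm_seq m \<Longrightarrow> 0 \<le> (bdiff ^^ k) m n"
  by (simp add: cm_seq_def)

lemma cm_seq_nonneg: "cm_seq m \<Longrightarrow> 0 \<le> m n"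
  using cm_seqD[of m 0 n] by simp

lemma bdiff_funpow_add: "(bdiff ^^ k) (\<lambda>n. f n + g n) n = (bdiff ^^ k) f n + (bdiff ^^ k) g n"
  by (induction k arbitrary: n) (simp_all add: bdiff_def)

lemma bdiff_funpow_cmult: "(bdiff ^^ k) (\<lambda>n. c * f n) n = c * (bdiff ^^ k) f n"
  by (induction k arbitrary: n) (simp_all add: bdiff_def algebra_simps)

lemma bdiff_funpow_shift: "(bdiff ^^ k) (\<lambda>n. f (Suc n)) n = (bdiff ^^ k) f (Suc n)"
  by (induction k arbitrary: n) (simp_all add: bdiff_def)

lemma bdiff_funpow_power: "(bdiff ^^ k) (\<lambda>n. r ^ n) n = (1 - r) ^ k * r ^ n"
  by (induction k arbitrary: n) (simp_all add: bdiff_def algebra_simps)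

lemma tendsto_bdiff_funpow:
  assumes "\<And>n. (\<lambda>j. F j n) \<longlonglongrightarrow> G n"
  shows "(\<lambda>j. (bdiff ^^ k) (F j) n) \<longlonglongrightarrow> (bdiff ^^ k) G n"
  by (induction k arbitrary: n) (simp_all add: bdiff_def assms tendsto_diff)

lemma has_integral_bdiff_funpow:
  fixes g :: "nat \<Rightarrow> 'b::euclidean_space \<Rightarrow> real"
  assumes "\<And>n. (g n has_integral J n) S"
  shows "((\<lambda>x. (bdiff ^^ k) (\<lambda>n. g n x) n) has_integral (bdiff ^^ k) J n) S"
  by (induction k arbitrary: n) (simp_all add: bdiff_def assms has_integral_diff)

lemma cm_seq_add: "cm_seq f \<Longrightarrow> cm_seq g \<Longrightarrow> cm_seq (\<lambda>n. f n + g n)"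
  by (simp add: cm_seq_def bdiff_funpow_add)

lemma cm_seq_cmult: "cm_seq f \<Longrightarrow> 0 \<le> c \<Longrightarrow> cm_seq (\<lambda>n. c * f n)"
  by (simp add: cm_seq_def bdiff_funpow_cmult)

lemma cm_seq_shift: "cm_seq f \<Longrightarrow> cm_seq (\<lambda>n. f (Suc n))"
  by (simp add: cm_seq_def bdiff_funpow_shift)

lemma cm_seq_bdiff: "cm_seq f \<Longrightarrow> cm_seq (bdiff f)"
  by (metis cm_seq_def comp_apply funpow_Suc_right)

lemma cm_seq_power: "0 \<le> r \<Longrightarrow> r \<le> 1 \<Longrightarrow> cm_seq (\<lambda>n. r ^ n)"
  by (simp add: cm_seq_def bdiff_funpow_power)

lemma cm_seq_one: "cm_seq (\<lambda>n. 1)"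
  using cm_seq_power[of 1] by simp

lemma cm_seq_LIMSEQ:
  assumes "\<And>j. cm_seq (F j)" "\<And>n. (\<lambda>j. F j n) \<longlonglongrightarrow> G n"
  shows "cm_seq G"
  unfolding cm_seq_def
proof (intro allI)
  fix k n
  show "0 \<le> (bdiff ^^ k) G n"
    using tendsto_bdiff_funpow[of F G k n, OF assms(2)]
    by (rule LIMSEQ_le_const) (use cm_seqD[OF assms(1)] in auto)
qed

text \<open>Iterated differences are finite linear combinations of terms, so they commute with the
  integral. A mixture of completely monotonic sequences therefore stays in the class.\<close>

lemma cm_seq_integral:
  fixes g :: "nat \<Rightarrow> 'b::euclidean_space \<Rightarrow> real"
  assumes "\<And>n. (g n has_integral J n) S" "\<And>x. x \<in> S \<Longrightarrow> cm_seq (\<lambda>n. g n x)"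
  shows "cm_seq J"
  unfolding cm_seq_def
  by (intro allI has_integral_nonneg[OF has_integral_bdiff_funpow[OF assms(1)]])
     (use assms(2) cm_seqD in blast)

text \<open>The discrete Leibniz rule writes \<open>bdiff\<close> of a product as a sum of two
  products, each again with completely monotonic factors. The induction on the order of the
  difference thus has to run over all pairs \<open>f\<close>, \<open>g\<close> at once.\<close>

lemma cm_seq_mult:
  assumes "cm_seq f" "cm_seq g"
  shows "cm_seq (\<lambda>n. f n * g n)"
proof -
  have "0 \<le> (bdiff ^^ k) (\<lambda>n. f n * g n) n" for k n
    using assms
  proof (induction k arbitrary: f g)
    case 0
    then show ?case by (simp add: cm_seq_nonneg)
  next
    case (Suc k)
    have "bdiff (\<lambda>n. f n * g n) = (\<lambda>n. bdiff f n * g n + f (Suc n) * bdiff g n)"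
      by (auto simp: bdiff_def algebra_simps)
    then show ?case
      using Suc.IH[OF cm_seq_bdiff[OF Suc.prems(1)] Suc.prems(2)]
        Suc.IH[OF cm_seq_shift[OF Suc.prems(1)] cm_seq_bdiff[OF Suc.prems(2)]]
      by (simp add: funpow_Suc_right bdiff_funpow_add del: funpow.simps)
  qed
  then show ?thesis by (simp add: cm_seq_def)
qed

lemma cm_seq_prod:
  assumes "\<And>k. k \<in> I \<Longrightarrow> cm_seq (F k)"
  shows "cm_seq (\<lambda>n. \<Prod>k\<in>I. F k n)"
  using assms by (induction I rule: infinite_finite_induct) (auto simp: cm_seq_one cm_seq_mult)

text \<open>The exponential series has nonnegative coefficients, so its partial sums in
  \<open>f n\<close> are completely monotonic by closure under sums and products, and the limit
  inherits this.\<close>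

lemma cm_seq_exp:
  assumes "cm_seq f"
  shows "cm_seq (\<lambda>n. exp (f n))"
proof (rule cm_seq_LIMSEQ)
  have pow: "cm_seq (\<lambda>n. f n ^ i)" for i
    by (induction i) (auto simp: cm_seq_one cm_seq_mult assms)
  show "cm_seq (\<lambda>n. \<Sum>i<j. inverse (fact i) * f n ^ i)" for j
  proof (induction j)
    case 0
    show ?case using cm_seq_cmult[OF cm_seq_one, of 0] by simp
  next
    case (Suc j)
    show ?case using cm_seq_add[OF Suc cm_seq_cmult[OF pow, of "inverse (fact j)"]] by simp
  qed
  show "(\<lambda>j. \<Sum>i<j. inverse (fact i) * f n ^ i) \<longlonglongrightarrow> exp (f n)" for n
    using summable_exp[THEN summable_LIMSEQ, of "f n"] by (simp add: exp_def divide_inverse mult.commute)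
qed

section \<open>Complete monotonicity of Gamma quotients along arithmetic progressions\<close>

text \<open>Each term is a Laplace integral over u \<ge> 0. At fixed u the integrand is a
  nonnegative number times the geometric sequence with ratio exp(-h u) in (0,1]. The offset
  \<open>c\<close> is the variable of a later integration; the step \<open>h\<close> allows sampling
  at fractions.\<close>

lemma cm_seq_sum_inverse_diff:
  fixes a b :: "'i \<Rightarrow> real"
  assumes fin: "finite I"
    and pos: "\<And>i. i \<in> I \<Longrightarrow> 0 < a i" "\<And>i. i \<in> I \<Longrightarrow> 0 < b i"
    and D: "\<And>u. 0 \<le> u \<Longrightarrow> (\<Sum>i\<in>I. exp (- b i * u)) \<le> (\<Sum>i\<in>I. exp (- a i * u))"
    and "0 \<le> c" "0 \<le> h"
  shows "cm_seq (\<lambda>n. \<Sum>i\<in>I. (1 / (a i + c + real n * h) - 1 / (b i + c + real n * h)))"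
proof (rule cm_seq_integral)
  let ?g = "\<lambda>n u. ((\<Sum>i\<in>I. exp (- a i * u)) - (\<Sum>i\<in>I. exp (- b i * u))) * exp (- c * u) * exp (- h * u) ^ n"
  show "(?g n has_integral (\<Sum>i\<in>I. (1 / (a i + c + real n * h) - 1 / (b i + c + real n * h)))) {0..}" for n
  proof -
    have e: "((\<lambda>u. exp (- (x + c + real n * h) * u)) has_integral 1 / (x + c + real n * h)) {0..}" if "x > 0" for x
      using has_integral_exp_minus_to_infinity[of "x + c + real n * h" 0] assms that
      by (simp add: add_pos_nonneg)
    have "?g n u = (\<Sum>i\<in>I. exp (- (a i + c + real n * h) * u) - exp (- (b i + c + real n * h) * u))" for u
      unfolding sum_subtractf [symmetric] sum_distrib_right
      by (intro sum.cong refl) (simp add: left_diff_distrib mult_exp_exp exp_of_nat_mult [symmetric] algebra_simps)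
    then show ?thesis
      by (simp only:) (intro has_integral_sum has_integral_diff e pos fin)
  qed
  show "cm_seq (\<lambda>n. ?g n u)" if "u \<in> {0..}" for u
    using D[of u] that assms by (intro cm_seq_cmult cm_seq_power) auto
qed

text \<open>Integrating the differences of reciprocals over the offset from 0 to T gives differences
  of logarithms. As T grows the boundary term at T vanishes, which leaves the logarithm of the
  product, and \<open>cm_seq_exp\<close> removes the logarithm.\<close>

lemma cm_seq_prod_quotient:
  fixes a b :: "'i \<Rightarrow> real"
  assumes fin: "finite I"
    and pos: "\<And>i. i \<in> I \<Longrightarrow> 0 < a i" "\<And>i. i \<in> I \<Longrightarrow> 0 < b i"
    and D: "\<And>u. 0 \<le> u \<Longrightarrow> (\<Sum>i\<in>I. exp (- b i * u)) \<le> (\<Sum>i\<in>I. exp (- a i * u))"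
    and h: "0 \<le> h"
  shows "cm_seq (\<lambda>n. \<Prod>i\<in>I. (b i + real n * h) / (a i + real n * h))"
proof -
  let ?L = "\<lambda>n v. \<Sum>i\<in>I. ln (a i + v + real n * h) - ln (b i + v + real n * h)"
  have "cm_seq (\<lambda>n. ?L n T - ?L n 0)" if T: "0 \<le> T" for T
  proof (rule cm_seq_integral[where S = "{0..T}"])
    show "((\<lambda>v. \<Sum>i\<in>I. 1 / (a i + v + real n * h) - 1 / (b i + v + real n * h)) has_integral
            (?L n T - ?L n 0)) {0..T}" for n
    proof (rule fundamental_theorem_of_calculus[OF T])
      fix v assume "v \<in> {0..T}"
      then have "0 < a i + v + real n * h" "0 < b i + v + real n * h" if "i \<in> I" for i
        using pos that h by (auto intro!: add_pos_nonneg)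
      then have "(?L n has_real_derivative (\<Sum>i\<in>I. 1 / (a i + v + real n * h) - 1 / (b i + v + real n * h)))
                   (at v within {0..T})"
        by (auto intro!: derivative_eq_intros sum.cong simp del: sum_subtractf)
      then show "(?L n has_vector_derivative (\<Sum>i\<in>I. 1 / (a i + v + real n * h) - 1 / (b i + v + real n * h)))
                   (at v within {0..T})"
        by (simp only: has_real_derivative_iff_has_vector_derivative)
    qed
    show "cm_seq (\<lambda>n. \<Sum>i\<in>I. 1 / (a i + v + real n * h) - 1 / (b i + v + real n * h))" if "v \<in> {0..T}" for v
      using that by (intro cm_seq_sum_inverse_diff assms) auto
  qed
  then have "cm_seq (\<lambda>n. ?L n (real j) - ?L n 0)" for j
    by simp
  moreover have "(\<lambda>j. ?L n (real j) - ?L n 0) \<longlonglongrightarrow> (\<Sum>i\<in>I. ln (b i + real n * h) - ln (a i + real n * h))" for n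
  proof -
    have "(\<lambda>j. ln (a i + real j + real n * h) - ln (b i + real j + real n * h)) \<longlonglongrightarrow> 0" if "i \<in> I" for i
      by real_asymp
    then have "(\<lambda>j. ?L n (real j)) \<longlonglongrightarrow> (\<Sum>i\<in>I. 0)"
      by (intro tendsto_sum)
    then have "(\<lambda>j. ?L n (real j) - ?L n 0) \<longlonglongrightarrow> (\<Sum>i\<in>I. 0) - ?L n 0"
      by (rule tendsto_diff[OF _ tendsto_const])
    then show ?thesis by (simp add: sum_subtractf)
  qed
  ultimately have "cm_seq (\<lambda>n. exp (\<Sum>i\<in>I. ln (b i + real n * h) - ln (a i + real n * h)))"
    by (intro cm_seq_exp) (rule cm_seq_LIMSEQ)
  moreover have "0 < a i + real n * h" "0 < b i + real n * h" if "i \<in> I" for i n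
    using pos that h by (auto intro!: add_pos_nonneg)
  then have "exp (\<Sum>i\<in>I. ln (b i + real n * h) - ln (a i + real n * h)) =
      (\<Prod>i\<in>I. (b i + real n * h) / (a i + real n * h))" for n
    by (auto intro!: prod.cong simp: fin exp_sum exp_diff simp del: sum_subtractf)
  ultimately show ?thesis by simp
qed

text \<open>In Euler's limit formula the approximant of index K is a positive constant times
  finitely many products of the preceding kind, with all parameters shifted by k \<le> K. Such a
  shift multiplies both sides of \<open>D\<close> by exp(-k u), so the hypothesis survives.\<close>

lemma cm_seq_prod_Gamma_quotient:
  fixes a b :: "'i \<Rightarrow> real"
  assumes fin: "finite I"
    and pos: "\<And>i. i \<in> I \<Longrightarrow> 0 < a i" "\<And>i. i \<in> I \<Longrightarrow> 0 < b i"
    and D: "\<And>u. 0 \<le> u \<Longrightarrow> (\<Sum>i\<in>I. exp (- b i * u)) \<le> (\<Sum>i\<in>I. exp (- a i * u))"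
    and h: "0 \<le> h"
  shows "cm_seq (\<lambda>n. \<Prod>i\<in>I. Gamma (a i + real n * h) / Gamma (b i + real n * h))"
proof (rule cm_seq_LIMSEQ)
  let ?F = "\<lambda>K n. \<Prod>i\<in>I. Gamma_series (a i + real n * h) K / Gamma_series (b i + real n * h) K"
  show "(\<lambda>K. ?F K n) \<longlonglongrightarrow> (\<Prod>i\<in>I. Gamma (a i + real n * h) / Gamma (b i + real n * h))" for n
  proof (intro tendsto_prod tendsto_divide Gamma_series_LIMSEQ)
    fix i assume "i \<in> I"
    then have "0 < b i + real n * h" using pos h by (auto intro!: add_pos_nonneg)
    then show "Gamma (b i + real n * h) \<noteq> 0" using Gamma_real_pos by (metis less_irrefl)
  qed
  show "cm_seq (?F K)" for K
  proof -
    have "?F K n = (\<Prod>i\<in>I. exp ((a i - b i) * ln K)) *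
        (\<Prod>k\<in>{0..<Suc K}. \<Prod>i\<in>I. ((b i + k) + real n * h) / ((a i + k) + real n * h))" for n
    proof -
      have "Gamma_series (a i + real n * h) K / Gamma_series (b i + real n * h) K =
          exp ((a i - b i) * ln K) * (\<Prod>k\<in>{0..<Suc K}. ((b i + k) + real n * h) / ((a i + k) + real n * h))"
        if "i \<in> I" for i
      proof -
        have quot: "Gamma_series x K / Gamma_series y K =
            exp (x * ln K) / exp (y * ln K) * (pochhammer y (Suc K) / pochhammer x (Suc K))" for x y :: real
          by (simp add: Gamma_series_def)
        \<comment> \<open>The part n h of the exponent cancels between numerator and denominator, so
          this factor does not depend on n.\<close>
        have "exp ((a i + real n * h) * ln K) / exp ((b i + real n * h) * ln K) = exp ((a i - b i) * ln K)"
          by (simp add: exp_diff [symmetric] algebra_simps)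
        then show ?thesis
          by (simp only: quot pochhammer_prod prod_dividef) (simp only: add_ac)
      qed
      then have "?F K n = (\<Prod>i\<in>I. exp ((a i - b i) * ln K) *
          (\<Prod>k\<in>{0..<Suc K}. ((b i + k) + real n * h) / ((a i + k) + real n * h)))"
        by (rule prod.cong[OF refl])
      then show ?thesis
        unfolding prod.distrib by (subst prod.swap)
    qed
    moreover have "cm_seq (\<lambda>n. (\<Prod>i\<in>I. exp ((a i - b i) * ln K)) *
        (\<Prod>k\<in>{0..<Suc K}. \<Prod>i\<in>I. ((b i + k) + real n * h) / ((a i + k) + real n * h)))"
    proof (rule cm_seq_cmult[OF cm_seq_prod[OF cm_seq_prod_quotient[OF fin _ _ _ h]]])
      fix u :: real and k :: nat assume u: "0 \<le> u"
      have "exp (- (x + real k) * u) = exp (- x * u) * exp (- real k * u)" for x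
        by (simp add: mult_exp_exp algebra_simps)
      then show "(\<Sum>i\<in>I. exp (- (b i + k) * u)) \<le> (\<Sum>i\<in>I. exp (- (a i + k) * u))"
        by (simp only: sum_distrib_right [symmetric]) (simp add: D[OF u, simplified])
    qed (auto intro!: add_pos_nonneg prod_nonneg pos)
    ultimately show ?thesis by simp
  qed
qed

section \<open>Exponential sums under weak supermajorization\<close>

text \<open>Abel summation in inductive form: replacing the weight \<open>w k\<close> by the smaller
  \<open>w (Suc k)\<close> can only decrease its product with a nonnegative partial sum.\<close>

lemma weighted_sum_ge:
  fixes w d :: "nat \<Rightarrow> real"
  assumes "\<And>i j. 1 \<le> i \<Longrightarrow> i \<le> j \<Longrightarrow> j \<le> q \<Longrightarrow> w j \<le> w i" 
    and "\<And>k. 1 \<le> k \<Longrightarrow> k \<le> q \<Longrightarrow> 0 \<le> (\<Sum>i=1..k. d i)"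
    and "1 \<le> k" "k \<le> q"
  shows "w k * (\<Sum>i=1..k. d i) \<le> (\<Sum>i=1..k. w i * d i)"
  using assms(3,4)
proof (induction k rule: dec_induct)
  case base
  show ?case by simp
next
  case (step k)
  have "w (Suc k) * (\<Sum>i=1..k. d i) \<le> w k * (\<Sum>i=1..k. d i)"
    using step assms(1)[of k "Suc k"] assms(2)[of k] by (intro mult_right_mono) auto
  then show ?case using step by (simp add: algebra_simps)
qed

text \<open>The tangent of the convex function exp(-x u) at \<open>b i\<close> bounds each
  difference below by \<open>?w i * (b i - a i)\<close>. These weights decrease in i because
  \<open>b\<close> increases, and the partial sums of \<open>b i - a i\<close> are nonnegative, so
  Abel summation applies.\<close>

lemma weak_supermaj_sum_exp_le:
  assumes maj: "weak_supermaj q b a" and u: "0 \<le> u"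
  shows "(\<Sum>i=1..q. exp (- b i * u)) \<le> (\<Sum>i=1..q. exp (- a i * u))"
proof (cases "q = 0")
  case False
  let ?w = "\<lambda>i. u * exp (- b i * u)"
  have "0 \<le> ?w q * (\<Sum>i=1..q. b i - a i)"
    using maj False u by (auto simp: weak_supermaj_def sum_subtractf)
  also have "\<dots> \<le> (\<Sum>i=1..q. ?w i * (b i - a i))"
    using maj False u
    by (intro weighted_sum_ge[where q = q])
       (auto simp: weak_supermaj_def sum_subtractf mono_on_def mult_right_mono intro!: mult_left_mono)
  also have "\<dots> \<le> (\<Sum>i=1..q. exp (- a i * u) - exp (- b i * u))"
  proof (rule sum_mono)
    fix i
    have "exp (- b i * u) * (1 + (b i - a i) * u) \<le> exp (- b i * u) * exp ((b i - a i) * u)"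
      by (intro mult_left_mono exp_ge_add_one_self) auto
    also have "\<dots> = exp (- a i * u)"
      by (simp add: mult_exp_exp algebra_simps)
    finally show "?w i * (b i - a i) \<le> exp (- a i * u) - exp (- b i * u)"
      by (simp add: algebra_simps)
  qed
  finally show ?thesis by (simp add: sum_subtractf)
qed simp

section \<open>The Hausdorff moment theorem\<close>

text \<open>With E the shift operator, \<open>bdiff\<close> is 1 - E. The sum is the binomial
  expansion of (bdiff + E)^N, that is of the identity, applied to \<open>f\<close> at
  \<open>p\<close>.\<close>

lemma sum_binomial_bdiff_funpow:
  "(\<Sum>j\<le>N. real (N choose j) * (bdiff ^^ (N - j)) f (p + j)) = f p"
proof (induction N arbitrary: f)
  case 0
  show ?case by simp
next
  case (Suc N)
  have step: "(bdiff ^^ k) (bdiff f) n = (bdiff ^^ Suc k) f n" for k n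
    by (simp add: funpow_Suc_right del: funpow.simps)
  have "(\<Sum>j\<le>N. real (N choose j) * (bdiff ^^ (N - j)) (bdiff f) (p + j)) =
      (\<Sum>j\<le>N. real (N choose j) * (bdiff ^^ (Suc N - j)) f (p + j))"
    by (intro sum.cong refl) (simp only: step, simp add: Suc_diff_le del: funpow.simps)
  also have "\<dots> = (\<Sum>j\<le>Suc N. real (N choose j) * (bdiff ^^ (Suc N - j)) f (p + j))"
    by simp
  also have "\<dots> = (bdiff ^^ Suc N) f p + (\<Sum>j\<le>N. real (N choose Suc j) * (bdiff ^^ (N - j)) f (Suc (p + j)))"
    by (subst sum.atMost_Suc_shift) (simp del: funpow.simps)
  finally have 1: "bdiff f p = \<dots>"
    using Suc.IH[of "bdiff f"] by simp
  have 2: "f (Suc p) = (\<Sum>j\<le>N. real (N choose j) * (bdiff ^^ (N - j)) f (Suc (p + j)))"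
    using Suc.IH[of "\<lambda>n. f (Suc n)"] by (simp add: bdiff_funpow_shift)
  have "(\<Sum>j\<le>Suc N. real (Suc N choose j) * (bdiff ^^ (Suc N - j)) f (p + j)) =
      bdiff f p + f (Suc p)"
    unfolding 1 2 
    by (subst sum.atMost_Suc_shift) (simp add: sum.distrib [symmetric] algebra_simps del: funpow.simps)
  also have "\<dots> = f p"
    by (simp add: bdiff_def)
  finally show ?case .
qed

text \<open>The product of the two binomials equals (N choose n) ((N - n) choose (j - n)), which
  reduces the sum to the preceding identity based at n. Hence the Bernstein weights reproduce
  binomial moments exactly, without an error term.\<close>

lemma sum_bernstein_weight_choose:
  assumes "n \<le> N"
  shows "(\<Sum>j\<le>N. real (N choose j) * (bdiff ^^ (N - j)) m j * real (j choose n)) = real (N choose n) * m n"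
proof -
  have "(\<Sum>j\<le>N. real (N choose j) * (bdiff ^^ (N - j)) m j * real (j choose n)) =
      (\<Sum>j\<in>{n..N}. real (N choose j) * (bdiff ^^ (N - j)) m j * real (j choose n))"
    by (rule sum.mono_neutral_right) auto
  also have "\<dots> = (\<Sum>j\<in>{n..N}. real (N choose n) * (real ((N - n) choose (j - n)) * (bdiff ^^ (N - j)) m j))"
  proof (intro sum.cong refl)
    fix j assume j: "j \<in> {n..N}"
    then have "real (N choose j) * real (j choose n) = real (N choose n) * real ((N - n) choose (j - n))"
      using choose_mult[of n j N] by (simp flip: of_nat_mult)
    then show "real (N choose j) * (bdiff ^^ (N - j)) m j * real (j choose n) =
        real (N choose n) * (real ((N - n) choose (j - n)) * (bdiff ^^ (N - j)) m j)"
      by (metis mult.assoc mult.commute)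
  qed
  also have "\<dots> = (\<Sum>i\<le>N - n. real (N choose n) * (real ((N - n) choose i) * (bdiff ^^ (N - n - i)) m (n + i)))"
    by (rule sum.reindex_bij_witness[of _ "\<lambda>i. n + i" "\<lambda>j. j - n"]) (use assms in auto)
  finally show ?thesis
    by (simp only: sum_distrib_left [symmetric] sum_binomial_bdiff_funpow)
qed

text \<open>Both quantities are products of n factors of modulus at most 1, so they differ by at
  most the sum of the factorwise differences. For fixed n the bound is O(1/N), uniformly in
  j.\<close>

lemma choose_quotient_approx:
  assumes "j \<le> N" "2 * n < N"
  shows "\<bar>real (j choose n) / real (N choose n) - (real j / real N) ^ n\<bar> \<le> real n * (real n / (real N - real n))"
proof -
  have "real (j choose n) / real (N choose n) = (\<Prod>i<n. (real j - real i) / (real N - real i))"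
    by (simp add: binomial_gbinomial gbinomial_prod_rev prod_dividef atLeast0LessThan)
  moreover have "(real j / real N) ^ n = (\<Prod>i<n. real j / real N)"
    by simp
  \<comment> \<open>For j < i the factor is negative; \<open>2 * n < N\<close> still keeps its
    modulus at most 1.\<close>
  moreover have "norm ((\<Prod>i<n. (real j - real i) / (real N - real i)) - (\<Prod>i<n. real j / real N)) \<le>
      (\<Sum>i<n. norm ((real j - real i) / (real N - real i) - real j / real N))"
    using assms by (intro norm_prod_diff) auto
  moreover have "\<dots> \<le> (\<Sum>i<n. real n / (real N - real n))"
  proof (rule sum_mono)
    fix i assume i: "i \<in> {..<n}"
    have "(real j - real i) / (real N - real i) - real j / real N =
        - ((real i / (real N - real i)) * ((real N - real j) / real N))"
      using i assms by (simp add: field_simps)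
    also have "norm \<dots> = (real i / (real N - real i)) * ((real N - real j) / real N)"
      using i assms by (simp add: abs_mult)
    also have "\<dots> \<le> (real n / (real N - real n)) * 1"
      using i assms by (intro mult_mono frac_le) auto
    finally show "norm ((real j - real i) / (real N - real i) - real j / real N) \<le> real n / (real N - real n)"
      by simp
  qed
  ultimately show ?thesis by simp
qed

theorem hausdorff_moment:
  assumes m: "cm_seq m" and m0: "m 0 = 1"
  shows "\<exists>\<nu>. real_distribution \<nu> \<and> (AE t in \<nu>. t \<in> {0..1}) \<and> (\<forall>n. (LINT t|\<nu>. t ^ n) = m n)"
proof -
  \<comment> \<open>The Bernstein measure \<open>\<mu> N\<close> has mass \<open>p N j\<close> at \<open>j / N\<close>; Helly selection gives a limit point.\<close>
  define p where "p N j = (if j \<le> N then real (N choose j) * (bdiff ^^ (N - j)) m j else 0)" for N j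
  define P where "P N = embed_pmf (p N)" for N
  define \<mu> where "\<mu> N = distr (measure_pmf (P N)) borel (\<lambda>j. real j / real N)" for N
  \<comment> \<open>Weak convergence tests only bounded continuous functions, which t^n is not.
    Clamping repairs this, leaves the atoms j/N fixed, and pushes the weak limit into [0,1] whatever
    its support.\<close>
  define clamp where "clamp t = max 0 (min 1 t)" for t :: real
  have p_nonneg: "0 \<le> p N j" for N j
    using cm_seqD[OF m] by (simp add: p_def)
  have p_sum: "(\<Sum>j\<le>N. p N j) = 1" for N
    using sum_binomial_bdiff_funpow[of N m 0] m0 by (simp add: p_def)
  have pmf_P: "pmf (P N) j = p N j" for N j
  proof -
    have "(\<integral>\<^sup>+ j. ennreal (p N j) \<partial>count_space UNIV) = (\<Sum>j\<le>N. ennreal (p N j))"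
      by (rule nn_integral_count_space') (auto simp: p_def)
    also have "\<dots> = 1"
      by (simp add: sum_ennreal p_nonneg p_sum)
    finally show ?thesis
      unfolding P_def by (intro pmf_embed_pmf p_nonneg)
  qed
  have supp: "j \<le> N" if "j \<in> set_pmf (P N)" for j N
    using that by (auto simp: set_pmf_eq pmf_P p_def split: if_splits)
  have real_dist: "real_distribution (\<mu> N)" for N
    unfolding \<mu>_def by (intro prob_space.real_distribution_distr prob_space_measure_pmf) auto
  \<comment> \<open>For N = 0 the quotient is 0 by the convention for division by zero.\<close>
  have unit: "0 \<le> real j / real N \<and> real j / real N \<le> 1" if "j \<le> N" for j N
    using that by (cases "N = 0") auto
  have "tight \<mu>"
    unfolding tight_def
  proof (intro conjI allI impI real_dist)
    fix e :: real assume "0 < e"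
    \<comment> \<open>Tightness is stated with intervals open on the left, so the left end must lie
      below the possible atom at 0.\<close>
    have "measure (\<mu> N) {-1<..2} = 1" for N
    proof -
      have "- 1 < real j / real N \<and> real j / real N \<le> 2" if "j \<in> set_pmf (P N)" for j
        using unit[OF supp[OF that]] by linarith
      then have "measure (measure_pmf (P N)) ((\<lambda>j. real j / real N) -` {-1<..2}) = 1"
        by (subst measure_pmf.prob_eq_1) (simp_all add: AE_measure_pmf_iff)
      then show ?thesis
        unfolding \<mu>_def by (subst measure_distr) simp_all
    qed
    then show "\<exists>x y. x < y \<and> (\<forall>N. 1 - e < measure (\<mu> N) {x<..y})"
      using \<open>0 < e\<close> by (intro exI[of _ "-1"] exI[of _ 2]) auto
  qed
  then obtain r M where r: "strict_mono r" and M: "real_distribution M" and weak: "weak_conv_m (\<mu> \<circ> id \<circ> r) M"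
    using tight_imp_convergent_subsubsequence[of \<mu> id] strict_mono_id by (auto simp: id_def)
  interpret M: real_distribution M by fact
  have int_clamp: "(LINT t|\<mu> N. clamp t ^ n) = (\<Sum>j\<le>N. p N j * (real j / real N) ^ n)" for N n
  proof -
    have "(LINT t|\<mu> N. clamp t ^ n) = (LINT j|measure_pmf (P N). clamp (real j / real N) ^ n)"
      unfolding \<mu>_def by (rule integral_distr) (auto simp: clamp_def)
    also have "\<dots> = (\<Sum>j\<le>N. clamp (real j / real N) ^ n * pmf (P N) j)"
      by (rule integral_measure_pmf_real) (auto dest: supp)
    also have "\<dots> = (\<Sum>j\<le>N. p N j * (real j / real N) ^ n)"
      using unit by (intro sum.cong refl) (simp add: clamp_def pmf_P)
    finally show ?thesis .
  qed
  have lim: "(\<lambda>N. LINT t|\<mu> N. clamp t ^ n) \<longlonglongrightarrow> m n" for n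
  proof (rule LIM_zero_cancel, rule Lim_null_comparison)
    show "\<forall>\<^sub>F N in sequentially. norm ((LINT t|\<mu> N. clamp t ^ n) - m n) \<le> real n * (real n / (real N - real n))"
      using eventually_gt_at_top[of "2 * n"]
    proof eventually_elim
      case (elim N)
      \<comment> \<open>The number \<open>m n\<close> is exactly the mean of (j choose n) / (N
        choose n); only the passage to (j/N)^n costs an error.\<close>
      have "m n = (\<Sum>j\<le>N. real (N choose j) * (bdiff ^^ (N - j)) m j * real (j choose n)) / real (N choose n)"
        using elim by (subst sum_bernstein_weight_choose) auto
      also have "\<dots> = (\<Sum>j\<le>N. p N j * (real (j choose n) / real (N choose n)))"
        by (simp add: p_def sum_divide_distrib)
      finally have "norm ((LINT t|\<mu> N. clamp t ^ n) - m n) =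
          \<bar>\<Sum>j\<le>N. p N j * ((real j / real N) ^ n - real (j choose n) / real (N choose n))\<bar>"
        by (simp add: int_clamp sum_subtractf right_diff_distrib)
      also have "\<dots> \<le> (\<Sum>j\<le>N. p N j * (real n * (real n / (real N - real n))))"
      proof (intro sum_abs[THEN order_trans] sum_mono)
        fix j assume "j \<in> {..N}"
        then have "\<bar>(real j / real N) ^ n - real (j choose n) / real (N choose n)\<bar> \<le> real n * (real n / (real N - real n))"
          using choose_quotient_approx[of j N n] elim by (simp only: abs_minus_commute atMost_iff)
        then show "\<bar>p N j * ((real j / real N) ^ n - real (j choose n) / real (N choose n))\<bar> \<le>
            p N j * (real n * (real n / (real N - real n)))"
          unfolding abs_mult abs_of_nonneg[OF p_nonneg] by (intro mult_left_mono p_nonneg)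
      qed
      also have "\<dots> = real n * (real n / (real N - real n))"
        by (simp only: sum_distrib_right [symmetric] p_sum)
      finally show ?case by simp
    qed
    show "(\<lambda>N. real n * (real n / (real N - real n))) \<longlonglongrightarrow> 0"
      by real_asymp
  qed
  define \<nu> where "\<nu> = distr M borel clamp"
  have clamp_meas [measurable]: "clamp \<in> borel_measurable borel"
    unfolding clamp_def by measurable
  have "real_distribution \<nu>"
    unfolding \<nu>_def by (intro prob_space.real_distribution_distr M.prob_space_axioms) auto
  moreover have "AE t in \<nu>. t \<in> {0..1}"
    unfolding \<nu>_def by (subst AE_distr_iff) (auto simp: clamp_def)
  moreover have "(LINT t|\<nu>. t ^ n) = m n" for n
  proof -
    have "(\<lambda>k. integral\<^sup>L ((\<mu> \<circ> id \<circ> r) k) (\<lambda>t. clamp t ^ n)) \<longlonglongrightarrow> (LINT t|M. clamp t ^ n)"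
    proof (rule weak_conv_imp_integral_bdd_continuous_conv[OF _ M weak])
      show "real_distribution ((\<mu> \<circ> id \<circ> r) k)" for k
        using real_dist by simp
      show "isCont (\<lambda>t. clamp t ^ n) t" for t
        unfolding clamp_def by (intro continuous_intros)
      show "norm (clamp t ^ n) \<le> 1" for t
        by (simp add: clamp_def power_abs power_le_one)
    qed
    moreover have "(\<lambda>k. integral\<^sup>L ((\<mu> \<circ> id \<circ> r) k) (\<lambda>t. clamp t ^ n)) \<longlonglongrightarrow> m n"
      using LIMSEQ_subseq_LIMSEQ[OF lim r, of n] by (simp add: o_def)
    ultimately have "(LINT t|M. clamp t ^ n) = m n"
      by (rule LIMSEQ_unique)
    then show ?thesis
      unfolding \<nu>_def by (subst integral_distr) auto
  qed
  ultimately show ?thesis by blast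
qed

section \<open>Moment measures for quotients of Gamma functions\<close>

text \<open>Rationality of \<open>\<gamma>\<close> = p/N places both the shift by
  \<open>\<gamma>\<close> and the integers on one grid of step 1/N, so Hausdorff's theorem for
  sequences suffices. Weighting by t^p and substituting t^N for t then turns the sampled moments
  into the required ones.\<close>

lemma hypergeom_moment_measure:
  assumes maj: "weak_supermaj q b a"
    and \<gamma>: "0 < \<gamma>" "\<gamma> \<in> \<rat>" "\<And>i. i \<in> {1..q} \<Longrightarrow> \<gamma> < a i"
  shows "\<exists>\<nu>. real_distribution \<nu> \<and> (AE t in \<nu>. 0 < t \<and> t \<le> 1) \<and>
           (\<forall>n. (LINT t|\<nu>. t ^ n) = (\<Prod>i=1..q. pochhammer (a i) n / pochhammer (b i) n)) \<and>
           integrable \<nu> (\<lambda>t. t powr - \<gamma>)"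
proof -
  obtain p N :: nat where pN: "0 < N" "0 < p" "\<gamma> = real p / real N"
    using Rats_abs_nat_div_natE[OF \<gamma>(2)] \<gamma>(1)
    by (metis abs_of_pos div_by_0 gr0I of_nat_0 divide_eq_0_iff less_irrefl)
  define h where "h = 1 / real N"
  have h: "0 \<le> h" and ph: "real p * h = \<gamma>" and Nh: "real N * h = 1"
    using pN by (simp_all add: h_def)
  \<comment> \<open>The first partial sum gives \<open>a 1 \<le> b 1\<close>, and \<open>b 1\<close>
    is the least of the \<open>b i\<close>.\<close>
  have b_pos: "\<gamma> < b i" if i: "i \<in> {1..q}" for i
  proof -
    have "\<forall>k\<in>{1..q}. (\<Sum>i=1..k. a i) \<le> (\<Sum>i=1..k. b i)"
      using maj by (simp add: weak_supermaj_def)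
    from bspec[OF this, of 1] have "a 1 \<le> b 1"
      using i by simp
    moreover have "b 1 \<le> b i"
      using maj i by (auto simp: weak_supermaj_def mono_on_def)
    ultimately show ?thesis using \<gamma>(3)[of 1] i by auto
  qed
  define G where "G n = (\<Prod>i=1..q. Gamma (a i - \<gamma> + real n * h) / Gamma (b i - \<gamma> + real n * h))" for n
  have Gam: "Gamma (a i - \<gamma> + real n * h) > 0" "Gamma (b i - \<gamma> + real n * h) > 0"
    if "i \<in> {1..q}" for i n
    using \<gamma>(3)[OF that] b_pos[OF that] h by (auto intro!: Gamma_real_pos add_pos_nonneg)
  have G_pos: "0 < G n" for n
    unfolding G_def by (intro prod_pos divide_pos_pos) (use Gam in auto)
  have "cm_seq G"
    unfolding G_def
  proof (rule cm_seq_prod_Gamma_quotient[OF _ _ _ _ h])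
    fix u :: real assume u: "0 \<le> u"
    have "exp (- (x - \<gamma>) * u) = exp (\<gamma> * u) * exp (- x * u)" for x
      by (simp add: mult_exp_exp algebra_simps)
    then show "(\<Sum>i=1..q. exp (- (b i - \<gamma>) * u)) \<le> (\<Sum>i=1..q. exp (- (a i - \<gamma>) * u))"
      using weak_supermaj_sum_exp_le[OF maj u] by (simp only: sum_distrib_left [symmetric]) simp
  qed (use \<gamma>(3) b_pos in auto)
  then have "cm_seq (\<lambda>n. inverse (G 0) * G n)"
    by (rule cm_seq_cmult) (use G_pos[of 0] in simp)
  then obtain \<rho> where \<rho>: "real_distribution \<rho>" "AE t in \<rho>. t \<in> {0..1}"
    and mom: "\<And>n. (LINT t|\<rho>. t ^ n) = inverse (G 0) * G n"
    using hausdorff_moment[of "\<lambda>n. inverse (G 0) * G n"] G_pos[of 0] by force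
  interpret \<rho>: real_distribution \<rho> by fact
  \<comment> \<open>The reciprocal of the p-th moment of \<open>\<rho>\<close>, so that the weighted
    measure has total mass 1.\<close>
  define c where "c = G 0 / G p"
  have c: "0 < c"
    unfolding c_def by (intro divide_pos_pos G_pos)
  \<comment> \<open>Up to a constant, this is the weight \<open>(t ^ N) powr \<gamma>\<close>, which undoes the shift by \<open>\<gamma>\<close>.\<close>
  define w where "w t = c * t ^ p" for t :: real
  have [measurable]: "w \<in> borel_measurable borel"
    unfolding w_def by measurable
  have w: "AE t in \<rho>. 0 \<le> w t"
    using \<rho>(2) by eventually_elim (use c in \<open>auto simp: w_def\<close>)
  define \<nu> where "\<nu> = distr (density \<rho> w) borel (\<lambda>t. t ^ N)"
  have sets_dens: "sets (density \<rho> w) = sets borel"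
    by simp
  have [measurable]: "(\<lambda>t::real. t ^ N) \<in> density \<rho> w \<rightarrow>\<^sub>M borel"
    by (simp add: measurable_cong_sets[OF sets_dens refl])
  have int_\<nu>: "integral\<^sup>L \<nu> g = (LINT t|\<rho>. w t * g (t ^ N))" 
    and integrable_\<nu>: "integrable \<nu> g \<longleftrightarrow> integrable \<rho> (\<lambda>t. w t * g (t ^ N))"
    if [measurable]: "g \<in> borel_measurable borel" for g :: "real \<Rightarrow> real"
    using w unfolding \<nu>_def
    by (simp_all add: integral_distr integrable_distr_eq integral_density integrable_density)
  have \<nu>_mom: "(LINT t|\<nu>. t ^ n) = (\<Prod>i=1..q. pochhammer (a i) n / pochhammer (b i) n)" for n
  proof -
    have "(LINT t|\<nu>. t ^ n) = (LINT t|\<rho>. c * t ^ (p + n * N))"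
      by (subst int_\<nu>) (auto simp: w_def power_add power_mult [symmetric] mult_ac)
    also have "\<dots> = c * (inverse (G 0) * G (p + n * N))"
      by (simp add: mom)
    also have "\<dots> = G (p + n * N) / G p"
      using G_pos[of 0] by (simp add: c_def)
    also have "\<dots> = (\<Prod>i=1..q. (Gamma (a i + n) / Gamma (a i)) / (Gamma (b i + n) / Gamma (b i)))"
    proof -
      have "real (p + n * N) * h = \<gamma> + n"
        using ph Nh by (simp add: algebra_simps)
      then show ?thesis
        unfolding G_def ph by (simp add: prod_dividef [symmetric] field_simps)
    qed
    also have "\<dots> = (\<Prod>i=1..q. pochhammer (a i) n / pochhammer (b i) n)"
    proof (intro prod.cong refl)
      fix i assume "i \<in> {1..q}"
      then have "0 < a i" "0 < b i" using maj by (auto simp: weak_supermaj_def)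
      then have "a i \<notin> \<int>\<^sub>\<le>\<^sub>0" "b i \<notin> \<int>\<^sub>\<le>\<^sub>0" by (auto elim!: nonpos_Ints_cases)
      then show "(Gamma (a i + n) / Gamma (a i)) / (Gamma (b i + n) / Gamma (b i)) = pochhammer (a i) n / pochhammer (b i) n"
        by (simp add: pochhammer_Gamma)
    qed
    finally show ?thesis .
  qed
  have "prob_space \<nu>"
  proof (rule prob_spaceI)
    have "(LINT t|\<nu>. (1::real)) = 1"
      using \<nu>_mom[of 0] by simp
    then have *: "(LINT t|\<rho>. w t) = 1" by (subst (asm) int_\<nu>) auto
    \<comment> \<open>A function that is not integrable has Bochner integral 0, so the value 1
      forces integrability.\<close>
    then have "integrable \<rho> w" using not_integrable_integral_eq by fastforce
    then have "(\<integral>\<^sup>+ t. ennreal (w t) \<partial>\<rho>) = 1"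
      by (simp add: nn_integral_eq_integral[OF _ w] *)
    then show "emeasure \<nu> (space \<nu>) = 1"
      unfolding \<nu>_def by (simp add: emeasure_distr emeasure_density)
  qed
  then have "real_distribution \<nu>"
    by (simp add: real_distribution_def real_distribution_axioms_def \<nu>_def)
  moreover have "AE t in \<nu>. 0 < t \<and> t \<le> 1"
  proof -
    \<comment> \<open>Since p > 0, the weight vanishes at t = 0 and removes any atom there.\<close>
    have "AE t in \<rho>. 0 < ennreal (w t) \<longrightarrow> 0 < t ^ N \<and> t ^ N \<le> 1"
      using \<rho>(2)
    proof eventually_elim
      case (elim t)
      show ?case
        using elim pN c by (cases "t = 0") (auto simp: w_def power_le_one zero_power)
    qed
    then show ?thesis
      unfolding \<nu>_def by (subst AE_distr_iff) (auto simp: AE_density)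
  qed
  moreover have "integrable \<nu> (\<lambda>t. t powr - \<gamma>)"
  proof -
    have "AE t in \<rho>. norm (w t * (t ^ N) powr - \<gamma>) \<le> c"
      using \<rho>(2)
    proof eventually_elim
      case (elim t)
      show ?case
      proof (cases "t = 0")
        case False
        then have t: "0 < t" using elim by simp
        \<comment> \<open>This cancels the weight t^p, so the integrand is bounded by
          \<open>c\<close>.\<close>
        then have "(t ^ N) powr - \<gamma> = t powr - real p"
          using pN by (simp add: powr_realpow [symmetric] powr_powr)
        then show ?thesis
          using t c by (simp add: w_def powr_minus powr_realpow)
      qed (use pN c in \<open>simp add: w_def zero_power\<close>)
    qed
    then have "integrable \<rho> (\<lambda>t. w t * (t ^ N) powr - \<gamma>)"
      by (rule \<rho>.integrable_const_bound) measurable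
    then show ?thesis by (subst integrable_\<nu>) auto
  qed
  ultimately show ?thesis using \<nu>_mom by blast
qed

section \<open>Stieltjes kernels\<close>

text \<open>Dominated convergence along sequences: on the convex ball the bound on
  \<open>f' z t\<close> also bounds the difference quotients. One null set has to serve all z in the
  ball, hence the quantifier inside \<open>AE\<close>.\<close>

lemma has_field_derivative_integral_param:
  fixes f :: "complex \<Rightarrow> 'a \<Rightarrow> complex"
  assumes fin: "finite_measure M" and r: "0 < r"
    and int: "\<And>z. z \<in> ball z0 r \<Longrightarrow> integrable M (f z)"
    and meas: "f' z0 \<in> borel_measurable M"
    and der: "AE t in M. \<forall>z\<in>ball z0 r. ((\<lambda>z. f z t) has_field_derivative f' z t) (at z) \<and> norm (f' z t) \<le> B"
  shows "((\<lambda>z. LINT t|M. f z t) has_field_derivative (LINT t|M. f' z0 t)) (at z0)"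
proof -
  interpret finite_measure M by fact
  have at_ball: "at z0 = at z0 within ball z0 r"
    using at_within_open[of z0 "ball z0 r"] r by simp
  show ?thesis
    unfolding has_field_derivative_iff at_ball tendsto_at_iff_sequentially
  proof (intro allI impI)
    fix X assume X: "\<forall>i. X i \<in> ball z0 r - {z0}" "X \<longlonglongrightarrow> z0"
    have "(\<lambda>i. LINT t|M. (f (X i) t - f z0 t) / (X i - z0)) \<longlonglongrightarrow> (LINT t|M. f' z0 t)"
    proof (rule integral_dominated_convergence[where w = "\<lambda>_. B"])
      show "(\<lambda>t. (f (X i) t - f z0 t) / (X i - z0)) \<in> borel_measurable M" for i
        using int[of "X i"] int[of z0] X(1) r by (auto intro!: borel_measurable_divide borel_measurable_diff)
      show "AE t in M. (\<lambda>i. (f (X i) t - f z0 t) / (X i - z0)) \<longlonglongrightarrow> f' z0 t"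
        using der
      proof eventually_elim
        case (elim t)
        then have "((\<lambda>z. f z t) has_field_derivative f' z0 t) (at z0)"
          using r by simp
        then show ?case
          using X unfolding has_field_derivative_iff at_ball tendsto_at_iff_sequentially
          by (auto simp: o_def)
      qed
      show "AE t in M. norm ((f (X i) t - f z0 t) / (X i - z0)) \<le> B" for i
        using der
      proof eventually_elim
        case (elim t)
        have "norm (f (X i) t - f z0 t) \<le> B * norm (X i - z0)"
          by (rule field_differentiable_bound[of "ball z0 r" "\<lambda>z. f z t" "\<lambda>z. f' z t"])
             (use elim X(1) r in \<open>auto intro: has_field_derivative_at_within\<close>)
        moreover have "0 < norm (X i - z0)"
          using X(1) by simp
        ultimately show ?case
          by (simp add: norm_divide divide_le_eq)
      qed
    qed (use meas in auto)
    moreover have "(LINT t|M. (f (X i) t - f z0 t) / (X i - z0)) =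
        ((LINT t|M. f (X i) t) - (LINT t|M. f z0 t)) / (X i - z0)" for i
      using int[of "X i"] int[of z0] X(1) r by simp
    ultimately show "((\<lambda>y. ((LINT t|M. f y t) - (LINT t|M. f z0 t)) / (y - z0)) \<circ> X) \<longlonglongrightarrow> (LINT t|M. f' z0 t)"
      by (simp only: o_def)
  qed
qed

text \<open>The power \<open>t ^ k\<close> closes the family under differentiation in z: the
  derivative of \<open>kernel k p\<close> is -p times \<open>kernel (Suc k) (p + 1)\<close>.\<close>

definition kernel :: "nat \<Rightarrow> real \<Rightarrow> complex \<Rightarrow> real \<Rightarrow> complex" where
  "kernel k p z t = of_real (t ^ k) * (1 + of_real t * z) powr of_real (- p)"

lemma open_slit: "open (- (of_real ` {..-1}) :: complex set)"
proof -
  have "closed (of_real ` {..-1} :: complex set)"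
    by (rule closed_injective_linear_image)
       (auto simp: linear_conv_bounded_linear bounded_linear_of_real intro: inj_of_real)
  then show ?thesis by (rule open_Compl)
qed

lemma kernel_base_slit:
  fixes z :: complex
  assumes z: "z \<notin> of_real ` {..-1}" and t: "0 \<le> t" "t \<le> 1"
  shows "1 + of_real t * z \<notin> \<real>\<^sub>\<le>\<^sub>0"
proof
  assume "1 + of_real t * z \<in> \<real>\<^sub>\<le>\<^sub>0"
  then obtain s where s: "s \<le> 0" "1 + of_real t * z = of_real s"
    by (auto elim!: nonpos_Reals_cases)
  then have t0: "0 < t"
    using t by (cases "t = 0") auto
  have "of_real t * z = of_real (s - 1)"
    using s(2) by (simp add: algebra_simps)
  then have "z = of_real ((s - 1) / t)"
    using t0 by (simp add: field_simps)
  moreover have "(s - 1) / t \<le> -1"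
    using t0 t s by (simp add: field_simps)
  ultimately show False using z by blast
qed

text \<open>The kernel is continuous on the compact set K \<times> [0,1], because its base avoids
  the branch cut there. The bound supplies both integrability and the domination for differentiating
  under the integral.\<close>

lemma kernel_bounded:
  assumes K: "compact K" "K \<inter> of_real ` {..-1} = {}"
  shows "\<exists>B. \<forall>z\<in>K. \<forall>t\<in>{0..1}. norm (kernel k p z t) \<le> B"
proof -
  let ?g = "\<lambda>(z, t). of_real (t ^ k) * exp (of_real (- p) * Ln (1 + of_real t * z)) :: complex"
  have base: "1 + of_real t * z \<notin> \<real>\<^sub>\<le>\<^sub>0" if "z \<in> K" "t \<in> {0..1}" for z t
    using kernel_base_slit[of z t] that K by auto
  have "continuous_on (K \<times> {0..1}) ?g"
    unfolding case_prod_unfold by (intro continuous_intros) (use base in auto)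
  then have "bounded (?g ` (K \<times> {0..1}))"
    by (intro compact_imp_bounded compact_continuous_image compact_Times K) auto
  then obtain B where B: "\<And>x. x \<in> K \<times> {0..1} \<Longrightarrow> norm (?g x) \<le> B"
    unfolding bounded_iff by blast
  have "norm (kernel k p z t) \<le> B" if "z \<in> K" "t \<in> {0..1}" for z t
  proof -
    have "1 + of_real t * z \<noteq> 0"
      using base[OF that] by (metis nonpos_Reals_zero_I)
    then have "kernel k p z t = ?g (z, t)"
      by (simp add: kernel_def powr_def)
    then show ?thesis using B[of "(z, t)"] that by simp
  qed
  then show ?thesis by blast
qed

lemma kernel_measurable [measurable]: "kernel k p z \<in> borel_measurable borel"
  unfolding kernel_def powr_def by measurable

lemma kernel_of_real:
  assumes "0 \<le> x" "0 \<le> t"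
  shows "kernel k p (of_real x) t = of_real (t ^ k * (1 + t * x) powr - p)"
  using powr_of_real[of "1 + t * x" "- p"] assms by (simp add: kernel_def)

lemma pochhammer_binomial_complex:
  fixes z :: complex
  assumes "norm z < 1"
  shows "(\<lambda>n. of_real (pochhammer p n / fact n) * (- z) ^ n) sums ((1 + z) powr of_real (- p))"
proof -
  have "(of_real (- p) gchoose n) * z ^ n = of_real (pochhammer p n / fact n) * (- z) ^ n" for n
    by (simp add: gbinomial_pochhammer pochhammer_of_real power_minus' power_minus[of z])
  then show ?thesis
    using gen_binomial_complex[OF assms, of "of_real (- p)"] by simp
qed

section \<open>Kernel integrals against a probability measure on (0,1]\<close>

locale unit_distribution = real_distribution M for M +
  assumes unit: "AE t in M. 0 < t \<and> t \<le> 1"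
begin

lemma integrable_kernel:
  assumes "z \<notin> of_real ` {..-1}"
  shows "integrable M (kernel k p z)"
proof -
  obtain B where B: "\<forall>t\<in>{0..1}. norm (kernel k p z t) \<le> B"
    using kernel_bounded[of "{z}" k p] assms by auto
  have "AE t in M. norm (kernel k p z t) \<le> B"
    using unit by eventually_elim (use B in auto)
  then show ?thesis
    by (rule integrable_const_bound) simp
qed

lemma kernel_integral_has_derivative:
  assumes z0: "z0 \<notin> of_real ` {..-1}"
  shows "((\<lambda>z. LINT t|M. kernel k p z t) has_field_derivative
           - of_real p * (LINT t|M. kernel (Suc k) (p + 1) z0 t)) (at z0)"
proof -
  obtain r where r: "0 < r" "cball z0 r \<subseteq> - (of_real ` {..-1})"
    using open_slit z0 unfolding open_contains_cball by (metis ComplI)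
  obtain B where B: "\<forall>z\<in>cball z0 r. \<forall>t\<in>{0..1}. norm (kernel (Suc k) (p + 1) z t) \<le> B"
    using kernel_bounded[of "cball z0 r" "Suc k" "p + 1"] r by auto
  have "((\<lambda>z. LINT t|M. kernel k p z t) has_field_derivative
           (LINT t|M. - of_real p * kernel (Suc k) (p + 1) z0 t)) (at z0)"
  proof (rule has_field_derivative_integral_param[where r = r and f' = "\<lambda>z t. - of_real p * kernel (Suc k) (p + 1) z t"
        and B = "\<bar>p\<bar> * B"])
    show "AE t in M. \<forall>z\<in>ball z0 r. ((\<lambda>z. kernel k p z t) has_field_derivative
            - of_real p * kernel (Suc k) (p + 1) z t) (at z) \<and>
            norm (- of_real p * kernel (Suc k) (p + 1) z t) \<le> \<bar>p\<bar> * B"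
      using unit
    proof eventually_elim
      case (elim t)
      show ?case
      proof (intro ballI conjI)
        fix z assume z: "z \<in> ball z0 r"
        then have "z \<notin> of_real ` {..-1}"
          using r(2) by (meson ComplD ball_subset_cball subsetD)
        then have base: "1 + of_real t * z \<notin> \<real>\<^sub>\<le>\<^sub>0"
          using elim by (intro kernel_base_slit) auto
        show "((\<lambda>z. kernel k p z t) has_field_derivative - of_real p * kernel (Suc k) (p + 1) z t) (at z)"
        proof -
          have "((\<lambda>z. 1 + of_real t * z) has_field_derivative of_real t) (at z)"
            by (auto intro!: derivative_eq_intros)
          from DERIV_cmult[OF DERIV_chain2[OF has_field_derivative_powr[OF base] this]]
          have "((\<lambda>z. kernel k p z t) has_field_derivative of_real (t ^ k) *
              (of_real (- p) * (1 + of_real t * z) powr (of_real (- p) - 1) * of_real t)) (at z)"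
            unfolding kernel_def .
          moreover have "complex_of_real (- (p + 1)) = of_real (- p) - 1"
            by simp
          ultimately show ?thesis
            unfolding kernel_def by (simp only:) (simp add: mult_ac)
        qed
        show "norm (- of_real p * kernel (Suc k) (p + 1) z t) \<le> \<bar>p\<bar> * B"
          using B z elim by (auto simp: norm_mult intro!: mult_left_mono)
      qed
    qed
    show "integrable M (kernel k p z)" if "z \<in> ball z0 r" for z
      using that r(2) by (intro integrable_kernel) (meson ComplD ball_subset_cball subsetD)
  qed (use r in \<open>auto intro: finite_measure_axioms\<close>)
  then show ?thesis by simp
qed

text \<open>The binomial series of the kernel is integrated term by term; for t in (0,1] its terms
  are dominated by their values at t = 1.\<close>

lemma kernel_integral_sums:
  assumes p: "0 < p" and z: "norm z < 1"
  shows "(\<lambda>n. of_real (pochhammer p n / fact n * (LINT t|M. t ^ n)) * (- z) ^ n) sums (LINT t|M. kernel 0 p z t)"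
proof -
  define f where "f n t = of_real (pochhammer p n / fact n * t ^ n) * (- z) ^ n" for n and t :: real
  \<comment> \<open>At the point -|z| the binomial series has nonnegative terms, and these are the
    majorant.\<close>
  have "(\<lambda>n. of_real (pochhammer p n / fact n) * (- (- of_real (norm z))) ^ n) sums
          ((1 - of_real (norm z)) powr of_real (- p) :: complex)"
    using pochhammer_binomial_complex[of "- of_real (norm z)" p] z by simp
  then have "summable (\<lambda>n. Re (of_real (pochhammer p n / fact n) * of_real (norm z) ^ n))"
    by (intro summable_Re) (simp add: sums_iff)
  then have summ: "summable (\<lambda>n. pochhammer p n / fact n * norm z ^ n)"
    by (simp flip: of_real_power of_real_mult del: of_real_divide)
  have le: "norm (f n t) \<le> pochhammer p n / fact n * norm z ^ n" if "0 < t" "t \<le> 1" for n t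
  proof -
    have "norm (f n t) = (pochhammer p n / fact n * norm z ^ n) * t ^ n"
      using that p by (simp add: f_def norm_mult norm_power norm_divide abs_mult abs_of_nonneg[OF pochhammer_nonneg])
    also have "\<dots> \<le> (pochhammer p n / fact n * norm z ^ n) * 1"
      using that p by (intro mult_left_mono power_le_one) (auto simp: pochhammer_nonneg)
    finally show ?thesis by simp
  qed
  have AE_le: "AE t in M. norm (f n t) \<le> pochhammer p n / fact n * norm z ^ n" for n
    using unit by eventually_elim (rule le, auto)
  have int: "integrable M (f n)" for n
    using AE_le by (rule integrable_const_bound) (simp add: f_def)
  have "(\<lambda>n. LINT t|M. f n t) sums (LINT t|M. (\<Sum>n. f n t))"
  proof (rule sums_integral[OF int])
    show "AE t in M. summable (\<lambda>n. norm (f n t))"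
      using unit
    proof eventually_elim
      case (elim t)
      show ?case
        by (rule summable_comparison_test'[OF summ, of 0]) (use elim le in simp)
    qed
    show "summable (\<lambda>n. LINT t|M. norm (f n t))"
    proof (rule summable_comparison_test'[OF summ])
      fix n
      have "(LINT t|M. norm (f n t)) \<le> (LINT t|M. pochhammer p n / fact n * norm z ^ n)"
        using int AE_le by (intro integral_mono_AE) auto
      then show "norm (LINT t|M. norm (f n t)) \<le> pochhammer p n / fact n * norm z ^ n"
        using prob_space by simp
    qed
  qed
  moreover have "(LINT t|M. (\<Sum>n. f n t)) = (LINT t|M. kernel 0 p z t)"
  proof (rule integral_cong_AE)
    show "AE t in M. (\<Sum>n. f n t) = kernel 0 p z t"
      using unit
    proof eventually_elim
      case (elim t)
      have "norm (of_real t * z) \<le> 1 * norm z"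
        unfolding norm_mult using elim by (intro mult_right_mono) auto
      then have "norm (of_real t * z) < 1"
        using z by simp
      from pochhammer_binomial_complex[OF this, of p] have
        "(\<lambda>n. of_real (pochhammer p n / fact n) * (- (of_real t * z)) ^ n) sums kernel 0 p z t"
        by (simp add: kernel_def)
      moreover have "of_real (pochhammer p n / fact n) * (- (of_real t * z)) ^ n = f n t" for n
      proof -
        have "- (of_real t * z) = of_real t * (- z)" by simp
        then show ?thesis
          by (simp only: f_def power_mult_distrib of_real_mult of_real_power mult.assoc)
      qed
      ultimately show ?case
        by (simp only: sums_iff)
    qed
  qed (auto simp: f_def)
  moreover have "(LINT t|M. f n t) = of_real (pochhammer p n / fact n * (LINT t|M. t ^ n)) * (- z) ^ n" for n
    unfolding f_def by (simp flip: integral_complex_of_real)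
  ultimately show ?thesis by simp
qed

lemma kernel_integral_of_real:
  assumes "0 \<le> x"
  shows "(LINT t|M. kernel k p (of_real x) t) = of_real (LINT t|M. t ^ k * (1 + t * x) powr - p)"
proof -
  have "(LINT t|M. kernel k p (of_real x) t) = (LINT t|M. of_real (t ^ k * (1 + t * x) powr - p))"
  proof (rule integral_cong_AE)
    show "AE t in M. kernel k p (of_real x) t = of_real (t ^ k * (1 + t * x) powr - p)"
      using unit by eventually_elim (rule kernel_of_real, use assms in auto)
  qed simp_all
  then show ?thesis by (simp only: integral_complex_of_real)
qed

text \<open>The n-th derivative at x > 0 is (-1)^n (p)_n times the integral of t^n (1 + t x)^(-p-n),
  which is nonnegative. As \<open>g\<close> is prescribed only for x > 0, derivatives are
  transferred on that open half-line.\<close>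

lemma kernel_integral_completely_monotonic:
  assumes p: "0 < p"
    and g: "\<And>x. 0 < x \<Longrightarrow> g x = Re (LINT t|M. kernel 0 p (of_real x) t)"
  shows "completely_monotonic g"
proof -
  define G where "G k x = Re (LINT t|M. kernel k (p + real k) (of_real x) t)" for k x
  have G_deriv: "(G k has_real_derivative - (p + real k) * G (Suc k) x) (at x)" if x: "0 < x" for k x
  proof -
    have "of_real x \<notin> (of_real ` {..-1} :: complex set)"
      using x by auto
    from kernel_integral_has_derivative[OF this, of k "p + real k"]
    have "((\<lambda>x. LINT t|M. kernel k (p + real k) (of_real x) t) has_vector_derivative
        - of_real (p + real k) * (LINT t|M. kernel (Suc k) (p + real k + 1) (of_real x) t)) (at x)"
      by (rule has_vector_derivative_real_field)
    then have "((\<lambda>x. Re (LINT t|M. kernel k (p + real k) (of_real x) t)) has_vector_derivative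
        Re (- of_real (p + real k) * (LINT t|M. kernel (Suc k) (p + real k + 1) (of_real x) t))) (at x)"
      by (rule bounded_linear.has_vector_derivative[OF bounded_linear_Re])
    moreover have "Re (- of_real (p + real k) * w) = - (p + real k) * Re w" for w
      by simp
    moreover have "p + real (Suc k) = p + real k + 1"
      by simp
    ultimately show ?thesis
      unfolding G_def has_real_derivative_iff_has_vector_derivative by (simp only:)
  qed
  have step: "((deriv ^^ n) g has_real_derivative (-1) ^ n * pochhammer p n * (- (p + real n) * G (Suc n) x)) (at x)"
    if "\<And>y. 0 < y \<Longrightarrow> (deriv ^^ n) g y = (-1) ^ n * pochhammer p n * G n y" "0 < x" for n x
    by (rule has_field_derivative_transform_within_open[where S = "{0<..}", OF DERIV_cmult[OF G_deriv]])
       (use that in auto)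
  have deriv_g: "(deriv ^^ n) g x = (-1) ^ n * pochhammer p n * G n x" if "0 < x" for n x
    using that
  proof (induction n arbitrary: x)
    case 0
    then show ?case by (simp add: g G_def)
  next
    case (Suc n)
    have "(deriv ^^ Suc n) g x = (-1) ^ n * pochhammer p n * (- (p + real n) * G (Suc n) x)"
      using DERIV_imp_deriv[OF step[OF Suc.IH Suc.prems]] by simp
    then show ?case
      by (simp add: pochhammer_rec' algebra_simps)
  qed
  show ?thesis
    unfolding completely_monotonic_def
  proof (intro allI impI conjI)
    fix n and x :: real assume x: "0 < x"
    have "((deriv ^^ n) g has_real_derivative (-1) ^ n * pochhammer p n * (- (p + real n) * G (Suc n) x)) (at x)"
      by (rule step[OF deriv_g x])
    then show "(deriv ^^ n) g field_differentiable at x"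
      by (auto simp: field_differentiable_def)
    have "0 \<le> G n x"
      using unit x by (auto simp: G_def kernel_integral_of_real intro!: integral_nonneg_AE elim!: eventually_mono)
    then show "0 \<le> (-1) ^ n * (deriv ^^ n) g x"
      using x p by (simp add: deriv_g pochhammer_nonneg flip: mult.assoc power_add)
  qed
qed

end

section \<open>The generalized Stieltjes representation and its order\<close>

text \<open>Factor 1 + t z = t (1/t + z); the principal power is multiplicative for a positive real
  factor. This is the substitution u = 1/t.\<close>

lemma stieltjes_kernel_eq:
  assumes "0 < t"
  shows "kernel 0 p z t = of_real (t powr - p) * (1 / (of_real (1 / t) + z) powr of_real p)"
proof -
  have "1 + of_real t * z = of_real t * (of_real (1 / t) + z)"
    using assms by (simp add: distrib_left)
  then have "(1 + of_real t * z) powr of_real (- p) =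
      of_real t powr of_real (- p) * (of_real (1 / t) + z) powr of_real (- p)"
    using powr_times_real_left[of "of_real t" "of_real (1 / t) + z" "of_real (- p)"] assms by simp
  also have "of_real t powr of_real (- p) = (of_real (t powr - p) :: complex)"
    using assms by (intro powr_of_real) auto
  also have "(of_real (1 / t) + z) powr of_real (- p) = 1 / (of_real (1 / t) + z) powr of_real p"
    by (simp add: powr_minus_divide)
  finally show ?thesis by (simp add: kernel_def)
qed

lemma nonpos_Reals_slit:
  fixes z :: complex
  assumes "z \<notin> \<real>\<^sub>\<le>\<^sub>0"
  shows "z \<notin> of_real ` {..-1}"
proof
  assume "z \<in> of_real ` {..-1}"
  then obtain s where "s \<le> -1" "z = of_real s" by auto
  then have "z \<in> \<real>\<^sub>\<le>\<^sub>0" by simp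
  then show False using assms by simp
qed

context unit_distribution
begin

text \<open>The integral is holomorphic off the cut and has the hypergeometric Taylor series at 0,
  so it witnesses that a continuation exists; uniqueness identifies it with
  \<open>hypergeom\<close>.\<close>

lemma hypergeom_eq_kernel_integral:
  assumes \<sigma>: "0 < \<sigma>"
    and mom: "\<And>n. (LINT t|M. t ^ n) = (\<Prod>i=1..q. pochhammer (a i) n / pochhammer (b i) n)"
    and z: "z \<notin> of_real ` {..-1}"
  shows "hypergeom q \<sigma> a b (- z) = (LINT t|M. kernel 0 \<sigma> z t)"
proof -
  let ?F = "\<lambda>z. LINT t|M. kernel 0 \<sigma> (- z) t"
  have slit: "- z \<notin> of_real ` {..-1}" if "z \<notin> of_real ` {1..}" for z :: complex
  proof
    assume "- z \<in> of_real ` {..-1}"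
    then obtain s where "s \<le> -1" "- z = of_real s" by auto
    then have "z = of_real (- s)" "1 \<le> - s"
      by (auto simp: minus_equation_iff[of z])
    then show False using that by blast
  qed
  have "hypergeom_continuation q \<sigma> a b ?F"
    unfolding hypergeom_continuation_def
  proof (intro conjI allI impI)
    have "(?F has_field_derivative (- of_real \<sigma> * (LINT t|M. kernel (Suc 0) (\<sigma> + 1) (- z) t)) * - 1) (at z)"
      if "z \<notin> of_real ` {1..}" for z
      by (rule DERIV_chain2[where f = "\<lambda>z. LINT t|M. kernel 0 \<sigma> z t" and g = uminus,
            OF kernel_integral_has_derivative[OF slit[OF that]]])
         (auto intro!: derivative_eq_intros)
    then show "?F holomorphic_on - (of_real ` {1..})"
      unfolding holomorphic_on_def
      by (meson ComplD field_differentiable_at_within field_differentiable_def)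
    fix z :: complex assume "norm z < 1"
    then have "(\<lambda>n. of_real (pochhammer \<sigma> n / fact n * (LINT t|M. t ^ n)) * z ^ n) sums ?F z"
      using kernel_integral_sums[OF \<sigma>, of "- z"] by simp
    moreover have "hypergeom_coeff q \<sigma> a b n = pochhammer \<sigma> n / fact n * (LINT t|M. t ^ n)" for n
      by (simp add: hypergeom_coeff_def mom prod_dividef)
    ultimately show "(\<lambda>n. of_real (hypergeom_coeff q \<sigma> a b n) * z ^ n) sums ?F z"
      by simp
  qed
  moreover have "- z \<notin> of_real ` {1..}"
  proof
    assume "- z \<in> of_real ` {1..}"
    then obtain s where "1 \<le> s" "- z = of_real s" by auto
    then have "z = of_real (- s)" "- s \<le> -1"
      by (auto simp: minus_equation_iff[of z])
    then show False using z by blast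
  qed
  ultimately show ?thesis
    using hypergeom_continuation_unique[of q \<sigma> a b ?F "- z"] by simp
qed

text \<open>The representing measure is the image of t^(-p) dM under u = 1/t, and the constant C is
  0.\<close>

lemma kernel_integral_in_stieltjes_class:
  assumes F: "\<And>z. z \<notin> \<real>\<^sub>\<le>\<^sub>0 \<Longrightarrow> F z = (LINT t|M. kernel 0 p z t)"
  shows "F \<in> stieltjes_class p"
proof -
  define \<mu> where "\<mu> = distr (density M (\<lambda>t. t powr - p)) borel (\<lambda>t. 1 / t)"
  have sets_dens: "sets (density M (\<lambda>t. t powr - p)) = sets borel"
    by simp
  have [measurable]: "(\<lambda>t::real. 1 / t) \<in> density M (\<lambda>t. t powr - p) \<rightarrow>\<^sub>M borel"
    by (simp add: measurable_cong_sets[OF sets_dens refl])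
  have "{..<0} \<in> null_sets \<mu>"
  proof -
    have "AE t in M. 1 / t \<notin> {..<0}"
      using unit by eventually_elim auto
    then have "AE u in \<mu>. u \<notin> {..<0}"
      unfolding \<mu>_def by (subst AE_distr_iff) (auto simp: AE_density elim: eventually_mono)
    then show ?thesis
      by (subst AE_iff_null_sets) (auto simp: \<mu>_def)
  qed
  moreover have "set_integrable \<mu> {0..} (\<lambda>u. 1 / (of_real u + z) powr of_real p) \<and>
      F z = of_real 0 + (LINT u:{0..}|\<mu>. 1 / (of_real u + z) powr of_real p)" if z: "z \<notin> \<real>\<^sub>\<le>\<^sub>0" for z
  proof -
    define g where "g u = indicator {0..} u *\<^sub>R (1 / (of_real u + z) powr of_real p)" for u :: real
    have [measurable]: "g \<in> borel_measurable borel"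
      unfolding g_def powr_def by measurable
    have AE: "AE t in M. t powr - p *\<^sub>R g (1 / t) = kernel 0 p z t"
      using unit
    proof eventually_elim
      case (elim t)
      then show ?case
        by (subst stieltjes_kernel_eq) (auto simp: g_def scaleR_conv_of_real)
    qed
    have "integrable M (\<lambda>t. t powr - p *\<^sub>R g (1 / t))"
      using integrable_kernel[OF nonpos_Reals_slit[OF z]] AE
      by (subst integrable_cong_AE) auto
    then have "integrable \<mu> g"
      unfolding \<mu>_def by (subst integrable_distr_eq) (auto simp: integrable_density)
    moreover have "integral\<^sup>L \<mu> g = (LINT t|M. t powr - p *\<^sub>R g (1 / t))"
      unfolding \<mu>_def by (subst integral_distr) (auto simp: integral_density)
    moreover have "\<dots> = F z"
      unfolding F[OF z] using AE by (intro integral_cong_AE) auto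
    ultimately show ?thesis
      unfolding set_integrable_def set_lebesgue_integral_def g_def by simp
  qed
  ultimately show ?thesis
    unfolding stieltjes_class_def
    by (intro CollectI exI[of _ 0] exI[of _ \<mu>] conjI allI impI) (auto simp: \<mu>_def)
qed

text \<open>The moment of order -\<open>\<gamma>\<close> makes F(x) decay like
  x^(-\<open>\<gamma>\<close>), too fast for a nonzero constant or a nonzero measure in order
  \<open>\<beta>\<close>. Then F(1) would be 0, whereas 1 + t \<le> 2 gives F(1) \<ge>
  2^(-p).\<close>

lemma kernel_integral_not_in_stieltjes_class:
  assumes F: "\<And>z. z \<notin> \<real>\<^sub>\<le>\<^sub>0 \<Longrightarrow> F z = (LINT t|M. kernel 0 p z t)"
    and \<gamma>: "integrable M (\<lambda>t. t powr - \<gamma>)" and \<beta>: "0 < \<beta>" "\<beta> < \<gamma>" "\<gamma> < p"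
  shows "F \<notin> stieltjes_class \<beta>"
proof
  assume "F \<in> stieltjes_class \<beta>"
  then obtain C \<mu> where C: "0 \<le> C" and \<mu> [measurable_cong]: "sets \<mu> = sets borel"
    and "\<forall>z. z \<notin> \<real>\<^sub>\<le>\<^sub>0 \<longrightarrow> set_integrable \<mu> {0..} (\<lambda>u. 1 / (of_real u + z) powr of_real \<beta>) \<and>
          F z = of_real C + (LINT u:{0..}|\<mu>. 1 / (of_real u + z) powr of_real \<beta>)"
    unfolding stieltjes_class_def mem_Collect_eq by (elim exE conjE) (rule that)
  then have int: "set_integrable \<mu> {0..} (\<lambda>u. 1 / (of_real u + z) powr of_real \<beta>)"
    and Fz: "F z = of_real C + (LINT u:{0..}|\<mu>. 1 / (of_real u + z) powr of_real \<beta>)" if "z \<notin> \<real>\<^sub>\<le>\<^sub>0" for z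
    using that by simp_all
  have space_\<mu>: "space \<mu> = UNIV"
    using sets_eq_imp_space_eq[OF \<mu>] by simp
  define R where "R x = (LINT t|M. (1 + t * x) powr - p)" for x
  define K where "K = (LINT t|M. t powr - \<gamma>)"
  define k where "k x u = indicator {0..} u * (u + x) powr - \<beta>" for x u :: real
  have pos: "of_real x \<notin> (\<real>\<^sub>\<le>\<^sub>0 :: complex set)" if "0 < x" for x
    using that by simp
  have k: "indicator {0..} u *\<^sub>R (1 / (of_real u + of_real x) powr of_real \<beta>) = complex_of_real (k x u)"
    if "0 < x" for x u
  proof (cases "0 \<le> u")
    case True
    then have "(of_real u + of_real x) powr of_real \<beta> = complex_of_real ((u + x) powr \<beta>)"
      using powr_of_real[of "u + x" \<beta>] that by simp
    then show ?thesis using True by (simp add: k_def powr_minus_divide)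
  qed (simp add: k_def)
  have k_int: "integrable \<mu> (k x)" if "0 < x" for x
    using int[OF pos[OF that]] unfolding set_integrable_def k[OF that] by (simp add: complex_of_real_integrable_eq)
  have R_eq: "R x = C + integral\<^sup>L \<mu> (k x)" if x: "0 < x" for x
  proof -
    have "complex_of_real (R x) = F (of_real x)"
      using kernel_integral_of_real[of x 0 p] x by (simp add: F[OF pos[OF x]] R_def)
    also have "\<dots> = of_real (C + integral\<^sup>L \<mu> (k x))"
      unfolding Fz[OF pos[OF x]] set_lebesgue_integral_def k[OF x] by simp
    finally show ?thesis by (simp only: of_real_eq_iff)
  qed
  have R_int: "integrable M (\<lambda>t. (1 + t * x) powr - p)" if "0 < x" for x
  proof (rule integrable_const_bound)
    show "AE t in M. norm ((1 + t * x) powr - p) \<le> 1"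
      using unit
    proof eventually_elim
      case (elim t)
      then have "0 < t * x"
        using that by simp
      then show ?case
        using powr_mono[of "- p" 0 "1 + t * x"] \<beta> by simp
    qed
    show "(\<lambda>t. (1 + t * x) powr - p) \<in> borel_measurable M"
      by measurable
  qed
  have R_le: "R x \<le> x powr - \<gamma> * K" if x: "0 < x" for x
  proof -
    have "R x \<le> (LINT t|M. x powr - \<gamma> * t powr - \<gamma>)"
      unfolding R_def
    proof (rule integral_mono_AE)
      show "AE t in M. (1 + t * x) powr - p \<le> x powr - \<gamma> * t powr - \<gamma>"
        using unit
      proof eventually_elim
        case (elim t)
        then have tx: "0 < t * x" using x by simp
        then have "(1 + t * x) powr - p \<le> (1 + t * x) powr - \<gamma>"
          using \<beta> by (intro powr_mono) auto
        also have "\<dots> \<le> (t * x) powr - \<gamma>"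
          using tx \<beta> by (intro powr_mono2') auto
        also have "\<dots> = x powr - \<gamma> * t powr - \<gamma>"
          using elim x by (simp add: powr_mult)
        finally show ?case .
      qed
    qed (use R_int[OF x] \<gamma> in auto)
    then show ?thesis by (simp add: K_def)
  qed
  have decay: "((\<lambda>x. x powr - s * L) \<longlongrightarrow> 0) at_top" if "0 < s" for s L :: real
    using tendsto_mult_left_zero[OF tendsto_neg_powr[OF _ filterlim_ident], of "- s" L] that by simp
  have le_0: "y \<le> 0" if "0 < s" "\<And>x. T \<le> x \<Longrightarrow> y \<le> x powr - s * L" for s L T y :: real
  proof (rule tendsto_lowerbound[OF decay[OF that(1)]])
    show "\<forall>\<^sub>F x in at_top. y \<le> x powr - s * L"
      using eventually_ge_at_top[of T] by eventually_elim (rule that(2))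
  qed simp
  have k_nonneg: "0 \<le> k x u" for x u
    by (simp add: k_def)
  have "C \<le> 0"
  proof (rule le_0)
    fix x :: real assume "1 \<le> x"
    moreover have "0 \<le> integral\<^sup>L \<mu> (k x)"
      by (rule integral_nonneg_AE) (simp add: k_nonneg)
    ultimately show "C \<le> x powr - \<gamma> * K"
      using R_eq[of x] R_le[of x] by simp
  qed (use \<beta> in simp)
  have K_nonneg: "0 \<le> K"
    unfolding K_def by (rule integral_nonneg_AE) simp
  have null: "emeasure \<mu> {0..T} = 0" if T: "0 \<le> T" for T
  proof -
    have le: "indicator {0..T} u * (T + x) powr - \<beta> \<le> k x u" if "0 < x" for x u
      using that \<beta> by (auto simp: k_def indicator_def intro!: powr_mono2')
    have ind_int: "integrable \<mu> (\<lambda>u. indicator {0..T} u * (T + x) powr - \<beta>)" if "0 < x" for x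
      by (rule Bochner_Integration.integrable_bound[OF k_int[OF that]])
         (use le[OF that] k_nonneg in \<open>auto simp: \<mu> abs_mult\<close>)
    \<comment> \<open>The kernel at x = 1 is bounded below on [0,T] by this constant, so [0,T] has
      finite mass.\<close>
    have "(T + 1) powr - \<beta> \<noteq> 0"
      using T by simp
    then have fin: "integrable \<mu> (indicator {0..T} :: real \<Rightarrow> real)"
      using ind_int[of 1] by simp
    \<comment> \<open>For x \<ge> T one has T + x \<le> 2 x, which produces the factor
      2^\<open>\<beta>\<close> and leaves a negative power of x.\<close>
    have "measure \<mu> {0..T} \<le> x powr - (\<gamma> - \<beta>) * (2 powr \<beta> * K)" if x: "max 1 T \<le> x" for x
    proof -
      have x0: "0 < x" using x by simp
      have "measure \<mu> {0..T} * (T + x) powr - \<beta> = (LINT u|\<mu>. indicator {0..T} u * (T + x) powr - \<beta>)"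
        using fin by (simp add: \<mu>)
      also have "\<dots> \<le> integral\<^sup>L \<mu> (k x)"
        by (intro integral_mono ind_int k_int le x0)
      also have "\<dots> \<le> x powr - \<gamma> * K"
        using R_eq[OF x0] R_le[OF x0] C by simp
      finally have "measure \<mu> {0..T} \<le> (x powr - \<gamma> * K) * (T + x) powr \<beta>"
        using T x0 by (simp add: powr_minus_divide field_simps)
      also have "\<dots> \<le> (x powr - \<gamma> * K) * (2 * x) powr \<beta>"
        using T x \<beta> K_nonneg by (intro mult_left_mono powr_mono2) auto
      also have "\<dots> = x powr - (\<gamma> - \<beta>) * (2 powr \<beta> * K)"
        using x0 by (simp add: powr_mult powr_diff powr_minus_divide)
      finally show ?thesis .
    qed
    note measure_le = this
    have "measure \<mu> {0..T} \<le> 0"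
    proof (rule le_0)
      show "0 < \<gamma> - \<beta>"
        using \<beta> by simp
      show "measure \<mu> {0..T} \<le> x powr - (\<gamma> - \<beta>) * (2 powr \<beta> * K)" if "max 1 T \<le> x" for x
        using that by (rule measure_le)
    qed
    then have "measure \<mu> {0..T} = 0"
      using measure_nonneg[of \<mu> "{0..T}"] by linarith
    \<comment> \<open>\<open>measure\<close> is also 0 on sets of infinite mass, so finiteness must
      accompany the vanishing.\<close>
    moreover have "emeasure \<mu> {0..T} \<noteq> top"
      using fin space_\<mu> unfolding integrable_indicator_iff by auto
    ultimately show ?thesis
      by (simp add: emeasure_eq_ennreal_measure)
  qed
  have nonneg_UN: "{0..} = (\<Union>n. {0..real n})"
    using real_arch_simple by auto
  have "{0..} \<in> null_sets \<mu>"
    unfolding nonneg_UN by (rule null_sets_UN) (simp add: null_sets_def null \<mu>)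
  from AE_not_in[OF this] have "AE u in \<mu>. k 1 u = 0"
    by eventually_elim (simp add: k_def)
  then have "integral\<^sup>L \<mu> (k 1) = 0"
    by (rule integral_eq_zero_AE)
  then have "R 1 \<le> 0"
    using R_eq[of 1] \<open>C \<le> 0\<close> by simp
  moreover have "(LINT t|M. 2 powr - p) \<le> R 1"
    unfolding R_def
  proof (rule integral_mono_AE)
    show "AE t in M. 2 powr - p \<le> (1 + t * 1) powr - p"
      using unit by eventually_elim (use \<beta> in \<open>auto intro!: powr_mono2'\<close>)
  qed (use R_int[of 1] in auto)
  then have "2 powr - p \<le> R 1"
    using prob_space by simp
  moreover have "0 < 2 powr - p"
    by simp
  ultimately show False
    by linarith
qed

end

theorem theorem3:
  fixes q :: nat and a b :: "nat \<Rightarrow> real" and \<sigma> :: real and f :: "complex \<Rightarrow> complex"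
  assumes q: "1 \<le> q"
    and maj: "weak_supermaj q b a"
    and sigma: "0 < \<sigma>" "\<sigma> \<le> Min (a ` {1..q})"
  defines "f \<equiv> \<lambda>z. hypergeom q \<sigma> a b (- z)"
  shows "exact_stieltjes_order f \<sigma> \<and>
         (\<forall>x>0. f (of_real x) \<in> \<real>) \<and>
         completely_monotonic (\<lambda>x. Re (f (of_real x)))"
proof -
  \<comment> \<open>The measure may vary with \<open>\<gamma>\<close> while \<open>f\<close> stays
    the same. One choice gives membership and complete monotonicity; to exclude an order
    \<open>\<beta>\<close> < \<open>\<sigma>\<close>, a \<open>\<gamma>\<close> between the two is
    chosen.\<close>
  have repr: "\<exists>\<nu>. unit_distribution \<nu> \<and> integrable \<nu> (\<lambda>t. t powr - \<gamma>) \<and>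
      (\<forall>z. z \<notin> \<real>\<^sub>\<le>\<^sub>0 \<longrightarrow> f z = (LINT t|\<nu>. kernel 0 \<sigma> z t))"
    if \<gamma>: "0 < \<gamma>" "\<gamma> < \<sigma>" "\<gamma> \<in> \<rat>" for \<gamma>
  proof -
    have "\<gamma> < a i" if "i \<in> {1..q}" for i
    proof -
      have "Min (a ` {1..q}) \<le> a i"
        using that by (intro Min_le) auto
      then show ?thesis using sigma(2) \<gamma>(2) by linarith
    qed
    then obtain \<nu> where \<nu>: "real_distribution \<nu>" "AE t in \<nu>. 0 < t \<and> t \<le> 1"
      and mom: "\<And>n. (LINT t|\<nu>. t ^ n) = (\<Prod>i=1..q. pochhammer (a i) n / pochhammer (b i) n)"
      and int: "integrable \<nu> (\<lambda>t. t powr - \<gamma>)"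
      using hypergeom_moment_measure[OF maj \<gamma>(1,3)] by blast
    interpret unit_distribution \<nu>
      using \<nu> by (simp add: unit_distribution_def unit_distribution_axioms_def)
    show ?thesis
      using int hypergeom_eq_kernel_integral[OF sigma(1) mom nonpos_Reals_slit] unit_distribution_axioms
      unfolding f_def by blast
  qed
  obtain \<gamma>0 where "\<gamma>0 \<in> \<rat>" "0 < \<gamma>0" "\<gamma>0 < \<sigma>"
    using Rats_dense_in_real[OF sigma(1)] by blast
  then obtain \<nu> where \<nu>: "unit_distribution \<nu>"
    and f: "\<And>z. z \<notin> \<real>\<^sub>\<le>\<^sub>0 \<Longrightarrow> f z = (LINT t|\<nu>. kernel 0 \<sigma> z t)"
    using repr by blast
  interpret unit_distribution \<nu> by (rule \<nu>)
  have mem: "f \<in> stieltjes_class \<sigma>"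
    by (rule kernel_integral_in_stieltjes_class[OF f])
  have "\<sigma> \<le> \<beta>" if \<beta>: "0 < \<beta>" "f \<in> stieltjes_class \<beta>" for \<beta>
  proof (rule ccontr)
    assume "\<not> \<sigma> \<le> \<beta>"
    then obtain \<gamma> where \<gamma>: "\<gamma> \<in> \<rat>" "\<beta> < \<gamma>" "\<gamma> < \<sigma>"
      using Rats_dense_in_real[of \<beta> \<sigma>] by auto
    then obtain \<nu>' where "unit_distribution \<nu>'" "integrable \<nu>' (\<lambda>t. t powr - \<gamma>)"
      "\<And>z. z \<notin> \<real>\<^sub>\<le>\<^sub>0 \<Longrightarrow> f z = (LINT t|\<nu>'. kernel 0 \<sigma> z t)"
      using repr[of \<gamma>] \<beta>(1) by force
    then show False
      using unit_distribution.kernel_integral_not_in_stieltjes_class[of \<nu>' f \<sigma> \<gamma> \<beta>] \<beta> \<gamma> by blast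
  qed
  then have "Inf {\<beta>. 0 < \<beta> \<and> f \<in> stieltjes_class \<beta>} = \<sigma>"
    using mem sigma(1) by (intro cInf_eq_minimum) auto
  then have "exact_stieltjes_order f \<sigma>"
    using mem sigma(1) by (auto simp: exact_stieltjes_order_def generalized_stieltjes_def)
  moreover have "f (of_real x) \<in> \<real>" if "0 < x" for x
    using kernel_integral_of_real[of x 0 \<sigma>] that by (simp add: f)
  moreover have "completely_monotonic (\<lambda>x. Re (f (of_real x)))"
    by (rule kernel_integral_completely_monotonic[OF sigma(1)]) (simp add: f)
  ultimately show ?thesis by blast
qed

end
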